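(* Let $m\ge 1$. Every minimal multiple unicast instance $\langle G,\{s_1-t_1,s_2-t_2\},\{1,m\}\rangle$ with two sessions, of rates $R_1=1$ and $R_2=m$, and with connectivity level $[1~m+1]$, is feasible.
   Context: A network is a finite directed acyclic graph $G=(V,E)$ (parallel edges allowed) in which every edge has unit capacity. A multiple unicast instance $\langle G,\{s_i-t_i\}_1^n,\{R_i\}_1^n\rangle$ consists of $G$ together with source nodes $s_i$ (having no incoming edges), terminal nodes $t_i$ (having no outgoing edges), and positive integer rates $R_i$. Source node $s_i$ observes $R_i$ independent unit-entropy messages, all of which must be communicated to $t_i$. The connectivity level is the vector $[k_1~\dots~k_n]$ where $k_i$ is the maximum flow from $s_i$ to $t_i$ in $G$. The instance is minimal if the removal of any edge from $E$ strictly reduces the connectivity level (i.e., decreases at least one $k_i$). Linear network codes: for a finite field $\mathbb{F}_q$ (with $q$ free to be chosen) and vector length $T\ge 1$, each unit-entropy message is a vector in $\mathbb{F}_q^T$; each edge carries a vector in $\mathbb{F}_q^T$ that is an $\mathbb{F}_q$-linear function of the vectors carried on the incoming edges of its tail and of the messages observed at its tail. The code is a solution if every terminal $t_i$ can recover all messages of $s_i$ (for all message values) from the vectors on its incoming edges. The case $T=1$ is called scalar, general $T$ is called vector linear network coding. The instance is feasible if it has a (scalar or vector) linear network coding solution for some $q$ and $T$. *)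

theory Defs
  imports Complex_Main "HOL-Library.FuncSet" "HOL-Algebra.Ring" "Graph_Theory.Digraph"
begin

section \<open>Maximum flows with unit edge capacities\<close>

definition unit_flow :: "('a, 'b) pre_digraph \<Rightarrow> 'a \<Rightarrow> 'a \<Rightarrow> ('b \<Rightarrow> real) \<Rightarrow> bool" where
  "unit_flow G u v f \<longleftrightarrow>
     (\<forall>e\<in>arcs G. 0 \<le> f e \<and> f e \<le> 1) \<and>
     (\<forall>w\<in>verts G - {u, v}. sum f (in_arcs G w) = sum f (out_arcs G w))"

definition flow_value :: "('a, 'b) pre_digraph \<Rightarrow> 'a \<Rightarrow> ('b \<Rightarrow> real) \<Rightarrow> real" where
  "flow_value G u f = sum f (out_arcs G u) - sum f (in_arcs G u)"

text \<open>The supremum is over a nonempty set (zero flow), bounded by the number of arcs when the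
  graph is finite, and is attained by compactness.\<close>

definition max_flow :: "('a, 'b) pre_digraph \<Rightarrow> 'a \<Rightarrow> 'a \<Rightarrow> real" where
  "max_flow G u v = Sup (flow_value G u ` {f. unit_flow G u v f})"


section \<open>Multiple unicast instances\<close>

text \<open>Sessions are indexed by \<open>{1..n}\<close>; the values of \<open>s\<close>, \<open>t\<close>, \<open>R\<close> outside this range are
  irrelevant.  Parallel arcs are allowed, since arcs are objects of their own.  Acyclicity also
  excludes loops.\<close>

locale multiple_unicast = fin_digraph G
  for G :: "('a, 'b) pre_digraph" +
  fixes n :: nat and s t :: "nat \<Rightarrow> 'a" and R :: "nat \<Rightarrow> nat"
  assumes acyclic: "acyclic (arcs_ends G)"
    and source_in_verts: "i \<in> {1..n} \<Longrightarrow> s i \<in> verts G"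
    and terminal_in_verts: "i \<in> {1..n} \<Longrightarrow> t i \<in> verts G"
    and source_no_in: "i \<in> {1..n} \<Longrightarrow> in_arcs G (s i) = {}"
    and terminal_no_out: "i \<in> {1..n} \<Longrightarrow> out_arcs G (t i) = {}"
    and rate_pos: "i \<in> {1..n} \<Longrightarrow> 0 < R i"

definition connectivity_level ::
    "('a, 'b) pre_digraph \<Rightarrow> nat \<Rightarrow> (nat \<Rightarrow> 'a) \<Rightarrow> (nat \<Rightarrow> 'a) \<Rightarrow> real list" where
  "connectivity_level G n s t = map (\<lambda>i. max_flow G (s i) (t i)) [1..<Suc n]"

definition minimal_instance ::
    "('a, 'b) pre_digraph \<Rightarrow> nat \<Rightarrow> (nat \<Rightarrow> 'a) \<Rightarrow> (nat \<Rightarrow> 'a) \<Rightarrow> bool" where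
  "minimal_instance G n s t \<longleftrightarrow>
     (\<forall>e\<in>arcs G. \<exists>i\<in>{1..n}.
        max_flow (pre_digraph.del_arc G e) (s i) (t i) < max_flow G (s i) (t i))"


section \<open>Linear network codes\<close>

text \<open>\<open>F\<^sup>T\<close> and the finite families \<open>(F\<^sup>T)\<^sup>J\<close> are represented by extensional functions.\<close>

definition vecs :: "('f, 'r) ring_scheme \<Rightarrow> nat \<Rightarrow> (nat \<Rightarrow> 'f) set" where
  "vecs F T = {..<T} \<rightarrow>\<^sub>E carrier F"

definition linear_function ::
    "('f, 'r) ring_scheme \<Rightarrow> nat \<Rightarrow> 'j set \<Rightarrow> (('j \<Rightarrow> nat \<Rightarrow> 'f) \<Rightarrow> nat \<Rightarrow> 'f) \<Rightarrow> bool" where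
  "linear_function F T J \<phi> \<longleftrightarrow>
     (\<forall>x \<in> J \<rightarrow>\<^sub>E vecs F T. \<phi> x \<in> vecs F T) \<and>
     (\<forall>x \<in> J \<rightarrow>\<^sub>E vecs F T. \<forall>y \<in> J \<rightarrow>\<^sub>E vecs F T.
        \<phi> (\<lambda>j\<in>J. \<lambda>k\<in>{..<T}. x j k \<oplus>\<^bsub>F\<^esub> y j k) = (\<lambda>k\<in>{..<T}. \<phi> x k \<oplus>\<^bsub>F\<^esub> \<phi> y k)) \<and>
     (\<forall>c \<in> carrier F. \<forall>x \<in> J \<rightarrow>\<^sub>E vecs F T.
        \<phi> (\<lambda>j\<in>J. \<lambda>k\<in>{..<T}. c \<otimes>\<^bsub>F\<^esub> x j k) = (\<lambda>k\<in>{..<T}. c \<otimes>\<^bsub>F\<^esub> \<phi> x k))"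

text \<open>Message \<open>(i, j)\<close>, for \<open>j < R i\<close>, is the \<open>j\<close>-th message of session \<open>i\<close>.\<close>

definition msg_index :: "nat \<Rightarrow> (nat \<Rightarrow> nat) \<Rightarrow> (nat \<times> nat) set" where
  "msg_index n R = (SIGMA i:{1..n}. {..<R i})"

definition messages ::
    "('f, 'r) ring_scheme \<Rightarrow> nat \<Rightarrow> nat \<Rightarrow> (nat \<Rightarrow> nat) \<Rightarrow> (nat \<times> nat \<Rightarrow> nat \<Rightarrow> 'f) set" where
  "messages F T n R = msg_index n R \<rightarrow>\<^sub>E vecs F T"

text \<open>What is available at a vertex: the messages observed there and its incoming arcs.\<close>

definition node_inputs ::
    "('a, 'b) pre_digraph \<Rightarrow> nat \<Rightarrow> (nat \<Rightarrow> 'a) \<Rightarrow> (nat \<Rightarrow> nat) \<Rightarrow> 'a \<Rightarrow> (nat \<times> nat + 'b) set" where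
  "node_inputs G n s R v = {p \<in> msg_index n R. s (fst p) = v} <+> in_arcs G v"

text \<open>A code is given by its global behaviour: \<open>y e X\<close> is the vector carried by arc \<open>e\<close> when the
  messages are \<open>X\<close>.  The local encoding function \<open>\<phi>\<close> at \<open>e\<close> does not depend on \<open>X\<close>.\<close>

definition linear_network_code ::
    "('a, 'b) pre_digraph \<Rightarrow> nat \<Rightarrow> (nat \<Rightarrow> 'a) \<Rightarrow> (nat \<Rightarrow> nat) \<Rightarrow> ('f, 'r) ring_scheme \<Rightarrow> nat \<Rightarrow>
     ('b \<Rightarrow> (nat \<times> nat \<Rightarrow> nat \<Rightarrow> 'f) \<Rightarrow> nat \<Rightarrow> 'f) \<Rightarrow> bool" where
  "linear_network_code G n s R F T y \<longleftrightarrow>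
     (\<forall>e\<in>arcs G. \<exists>\<phi>. linear_function F T (node_inputs G n s R (tail G e)) \<phi> \<and>
        (\<forall>X\<in>messages F T n R.
           y e X = \<phi> (restrict (case_sum X (\<lambda>e'. y e' X)) (node_inputs G n s R (tail G e)))))"

definition code_solves ::
    "('a, 'b) pre_digraph \<Rightarrow> nat \<Rightarrow> (nat \<Rightarrow> 'a) \<Rightarrow> (nat \<Rightarrow> nat) \<Rightarrow> ('f, 'r) ring_scheme \<Rightarrow> nat \<Rightarrow>
     ('b \<Rightarrow> (nat \<times> nat \<Rightarrow> nat \<Rightarrow> 'f) \<Rightarrow> nat \<Rightarrow> 'f) \<Rightarrow> bool" where
  "code_solves G n t R F T y \<longleftrightarrow>
     (\<forall>i\<in>{1..n}. \<exists>dec. \<forall>X\<in>messages F T n R. \<forall>j<R i.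
        dec (\<lambda>e\<in>in_arcs G (t i). y e X) j = X (i, j))"

text \<open>Fields with carrier in the type \<open>int\<close> lose no generality: every finite field is isomorphic
  to one of these.\<close>

definition feasible ::
    "('a, 'b) pre_digraph \<Rightarrow> nat \<Rightarrow> (nat \<Rightarrow> 'a) \<Rightarrow> (nat \<Rightarrow> 'a) \<Rightarrow> (nat \<Rightarrow> nat) \<Rightarrow> bool" where
  "feasible G n s t R \<longleftrightarrow>
     (\<exists>(F :: int ring) T y. field F \<and> finite (carrier F) \<and> 1 \<le> T \<and>
        linear_network_code G n s R F T y \<and> code_solves G n t R F T y)"

end

(* The max-flow/min-cut argument gives m + 1 arc-disjoint paths from s_2 to t_2 and one walk from
   s_1 to t_1.  Let i_1, ..., i_r be the paths that the walk joins, where a path once joined is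
   followed up to its last arc on the walk, so that the i_k are distinct.  Start path i with b_i,
   where the b_i are messages of s_2 except that b_{i_1} = -(b_{i_2} + ... + b_{i_r}), and start
   the walk with the message a of s_1.  At each meeting the values of the walk and the path are
   added, so path i_k carries c_k = a - (b_{i_{k+1}} + ... + b_{i_r}) after its meeting, and t_1
   receives c_r = a.  The terminal t_2 receives all c_k and the untouched b_i, hence recovers
   b_{i_k} = c_k - c_{k-1} for k >= 2.  All coefficients are integers, so the code can be read
   over the field with two elements. *)

theory Submission
  imports Defs "Graph_Theory.Arc_Walk" "HOL-Number_Theory.Residues" "HOL-Library.Function_Algebras"
begin

section \<open>Cuts and balanced arc sets\<close>

text \<open>The arc set \<open>A\<close> is a parameter of its own, so that arcs can be discarded
  while the graph stays fixed.\<close>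

definition cut_arcs :: "('a, 'b) pre_digraph \<Rightarrow> 'b set \<Rightarrow> 'a set \<Rightarrow> 'b set" where
  "cut_arcs G A S = {e \<in> A. tail G e \<in> S \<and> head G e \<notin> S}"

section \<open>Flows are bounded by cuts\<close>

lemma (in fin_digraph) sum_over_in_arcs:
  assumes "S \<subseteq> verts G"
  shows "(\<Sum>w\<in>S. sum f (in_arcs G w)) = sum f {e \<in> arcs G. head G e \<in> S}"
proof -
  have "(\<Sum>w\<in>S. sum f (in_arcs G w)) = sum f (\<Union>w\<in>S. in_arcs G w)"
    using assms by (intro sum.UNION_disjoint[symmetric]) (auto intro: finite_subset)
  also have "(\<Union>w\<in>S. in_arcs G w) = {e \<in> arcs G. head G e \<in> S}" by auto
  finally show ?thesis .
qed

lemma (in fin_digraph) sum_over_out_arcs: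
  assumes "S \<subseteq> verts G"
  shows "(\<Sum>w\<in>S. sum f (out_arcs G w)) = sum f {e \<in> arcs G. tail G e \<in> S}"
proof -
  have "(\<Sum>w\<in>S. sum f (out_arcs G w)) = sum f (\<Union>w\<in>S. out_arcs G w)"
    using assms by (intro sum.UNION_disjoint[symmetric]) (auto intro: finite_subset)
  also have "(\<Union>w\<in>S. out_arcs G w) = {e \<in> arcs G. tail G e \<in> S}" by auto
  finally show ?thesis .
qed

text \<open>Summing conservation over the vertices in \<open>S\<close> cancels the flow on arcs
  inside \<open>S\<close>. What remains is the flow leaving \<open>S\<close> minus the flow entering
  it, and each leaving arc carries at most 1.\<close>

lemma (in fin_digraph) flow_value_le_cut:
  assumes f: "unit_flow G u v f" and "u \<in> verts G" "u \<in> S" "v \<notin> S"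
  shows "flow_value G u f \<le> real (card (cut_arcs G (arcs G) S))"
proof -
  define V where "V = S \<inter> verts G"
  let ?O = "{e \<in> arcs G. tail G e \<in> V}" and ?I = "{e \<in> arcs G. head G e \<in> V}"
  have V: "V \<subseteq> verts G" "u \<in> V" "v \<notin> V" "finite V"
    using assms by (auto simp: V_def)
  have cons: "sum f (out_arcs G w) - sum f (in_arcs G w) = 0" if "w \<in> V - {u}" for w
  proof -
    have "w \<in> verts G - {u, v}" using that V by auto
    then show ?thesis using f by (simp add: unit_flow_def)
  qed
  have "flow_value G u f = (\<Sum>w\<in>V. sum f (out_arcs G w) - sum f (in_arcs G w))"
    unfolding flow_value_def using V cons by (simp add: sum.remove[of V u])
  also have "\<dots> = sum f ?O - sum f ?I"
    using V by (simp add: sum_subtractf sum_over_in_arcs sum_over_out_arcs)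
  also have "\<dots> = sum f (?O - ?I) - sum f (?I - ?O)"
  proof -
    have "sum f ?O = sum f (?O - ?I) + sum f (?O \<inter> ?I)"
      "sum f ?I = sum f (?I - ?O) + sum f (?O \<inter> ?I)"
      using sum.Int_Diff[of ?O f ?I] sum.Int_Diff[of ?I f ?O] by (simp_all add: Int_commute)
    then show ?thesis by simp
  qed
  also have "\<dots> \<le> sum f (?O - ?I)"
  proof -
    have "0 \<le> sum f (?I - ?O)" using f by (intro sum_nonneg) (auto simp: unit_flow_def)
    then show ?thesis by simp
  qed
  also have "\<dots> \<le> (\<Sum>e\<in>?O - ?I. 1)"
    using f by (intro sum_mono) (auto simp: unit_flow_def)
  also have "?O - ?I = cut_arcs G (arcs G) S"
    by (auto simp: cut_arcs_def V_def)
  finally show ?thesis by simp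
qed

lemma (in fin_digraph) max_flow_le_cut:
  assumes "u \<in> verts G" "u \<in> S" "v \<notin> S"
  shows "max_flow G u v \<le> real (card (cut_arcs G (arcs G) S))"
  unfolding max_flow_def
proof (rule cSup_least)
  have "unit_flow G u v (\<lambda>_. 0)" by (simp add: unit_flow_def)
  then show "flow_value G u ` {f. unit_flow G u v f} \<noteq> {}" by auto
qed (use assms flow_value_le_cut in auto)

text \<open>Serves to separate a source from its terminal: if both were the same node, that node
  would have no arcs at all.\<close>

lemma max_flow_isolated:
  assumes "in_arcs G u = {}" "out_arcs G u = {}"
  shows "max_flow G u v = 0"
proof -
  have "unit_flow G u v (\<lambda>_. 0)" by (simp add: unit_flow_def)
  then have "flow_value G u ` {f. unit_flow G u v f} = {0}"
    using assms by (auto simp: flow_value_def)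
  then show ?thesis by (simp add: max_flow_def)
qed

text \<open>The set reachable from \<open>u\<close> has no leaving arc; if it missed
  \<open>v\<close>, this empty cut would bound the maximum flow by 0.\<close>

lemma (in fin_digraph) positive_max_flow_awalk:
  assumes "u \<in> verts G" "0 < max_flow G u v"
  obtains p where "awalk u p v"
proof -
  let ?S = "{w. \<exists>p. awalk u p w}"
  have "v \<in> ?S"
  proof (rule ccontr)
    assume "v \<notin> ?S"
    moreover have "u \<in> ?S" using assms awalk_Nil_iff by auto
    ultimately have "max_flow G u v \<le> real (card (cut_arcs G (arcs G) ?S))"
      using assms by (intro max_flow_le_cut)
    moreover have "awalk u (p @ [e]) (head G e)" if "e \<in> arcs G" "awalk u p (tail G e)" for p e
      using that by (auto simp: awalk_Cons_iff awalk_Nil_iff)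
    then have "cut_arcs G (arcs G) ?S = {}" unfolding cut_arcs_def by blast
    ultimately show False using assms by simp
  qed
  then show thesis using that by blast
qed

text \<open>The inequality holds arc by arc, by the positions of tail and head. The third term is
  slack: an arc from \<open>S - T\<close> to \<open>T - S\<close> crosses \<open>S\<close>, but
  neither \<open>S \<inter> T\<close> nor \<open>S \<union> T\<close>.\<close>

lemma cut_arcs_submodular:
  assumes "finite A"
  shows "card (cut_arcs G A (S \<inter> T)) + card (cut_arcs G A (S \<union> T))
      + card {e \<in> A. tail G e \<in> S - T \<and> head G e \<in> T - S}
    \<le> card (cut_arcs G A S) + card (cut_arcs G A T)"
proof -
  have c: "card {e \<in> A. P e} = (\<Sum>e\<in>A. if P e then 1 else 0 :: nat)" for P
    using assms by (simp add: sum.If_cases Int_def)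
  show ?thesis
    unfolding cut_arcs_def c sum.distrib[symmetric] by (intro sum_mono) auto
qed

text \<open>Deleting arcs while every cut keeps size \<open>k\<close> ends in a set in which every arc crosses a
  tight cut.  Tight cuts have no entering arcs and are closed under union and intersection;
  moving a vertex \<open>v\<close> across a tight cut that separates it from all its neighbours on one side
  compares its in-degree with its out-degree.\<close>

lemma (in fin_digraph) balanced_subset_of_cuts:
  assumes cuts: "\<And>S. u \<in> S \<Longrightarrow> v \<notin> S \<Longrightarrow> k \<le> card (cut_arcs G (arcs G) S)"
  obtains A where "A \<subseteq> arcs G"
    and "\<And>S. u \<in> S \<Longrightarrow> v \<notin> S \<Longrightarrow> k \<le> card (cut_arcs G A S)"
    and "\<And>w. w \<noteq> u \<Longrightarrow> w \<noteq> v \<Longrightarrow> card {e \<in> A. head G e = w} = card {e \<in> A. tail G e = w}"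
proof -
  define C where "C A \<longleftrightarrow> (\<forall>S. u \<in> S \<longrightarrow> v \<notin> S \<longrightarrow> k \<le> card (cut_arcs G A S))" for A
  have "finite {A. A \<subseteq> arcs G \<and> C A}" "arcs G \<in> {A. A \<subseteq> arcs G \<and> C A}"
    using cuts by (auto simp: C_def)
  then obtain A where A: "A \<subseteq> arcs G" "C A"
    and min: "\<And>B. B \<subseteq> arcs G \<Longrightarrow> C B \<Longrightarrow> B \<subseteq> A \<Longrightarrow> B = A"
    using finite_has_minimal[of "{A. A \<subseteq> arcs G \<and> C A}"] by (metis (no_types, lifting) empty_iff mem_Collect_eq)
  have fin: "finite A" using finite_subset[OF A(1)] by simp
  then have fin_cut: "finite (cut_arcs G A S)" for S by (simp add: cut_arcs_def)
  define tight where "tight S \<longleftrightarrow> u \<in> S \<and> v \<notin> S \<and> card (cut_arcs G A S) = k" for S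
  have lower: "k \<le> card (cut_arcs G A S)" if "u \<in> S" "v \<notin> S" for S
    using A that by (auto simp: C_def)
  \<comment> \<open>Otherwise \<open>e\<close> could be deleted, against the minimality of
    \<open>A\<close>. A cut that falls below \<open>k\<close> without \<open>e\<close> has exactly
    \<open>k\<close> arcs with it.\<close>
  have crosses: "\<exists>S. tight S \<and> e \<in> cut_arcs G A S" if e: "e \<in> A" for e
  proof -
    have "\<not> C (A - {e})" using min[of "A - {e}"] A e by auto
    then obtain S where S: "u \<in> S" "v \<notin> S" "card (cut_arcs G (A - {e}) S) < k"
      unfolding C_def by force
    have eq: "cut_arcs G (A - {e}) S = cut_arcs G A S - {e}" by (auto simp: cut_arcs_def)
    have "k \<le> card (cut_arcs G A S)" using lower S by simp
    moreover from this S eq have "e \<in> cut_arcs G A S" by (metis Diff_insert0 Diff_empty leD)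
    ultimately have "card (cut_arcs G A S) = k"
      using S(3) fin_cut unfolding eq by (simp add: card_Diff_singleton)
    then show ?thesis using S \<open>e \<in> cut_arcs G A S\<close> by (auto simp: tight_def)
  qed
  have no_loop: "tail G e \<noteq> head G e" if "e \<in> A" for e
    using crosses[OF that] by (auto simp: cut_arcs_def)
  \<comment> \<open>Both cuts on the left of submodularity have at least \<open>k\<close> arcs and
    the right side is \<open>2k\<close>; so both are tight and the slack is 0.\<close>
  have lattice: "tight (S \<inter> T)" "tight (S \<union> T)" "{e \<in> A. tail G e \<in> S - T \<and> head G e \<in> T - S} = {}"
    if "tight S" "tight T" for S T
  proof -
    let ?X = "{e \<in> A. tail G e \<in> S - T \<and> head G e \<in> T - S}"
    have "k \<le> card (cut_arcs G A (S \<inter> T))" "k \<le> card (cut_arcs G A (S \<union> T))"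
      using that lower by (auto simp: tight_def)
    moreover have "card (cut_arcs G A S) = k" "card (cut_arcs G A T) = k"
      using that by (auto simp: tight_def)
    moreover note cut_arcs_submodular[OF fin, of G S T]
    ultimately have "card (cut_arcs G A (S \<inter> T)) = k" "card (cut_arcs G A (S \<union> T)) = k" "card ?X = 0"
      by linarith+
    with that fin show "tight (S \<inter> T)" "tight (S \<union> T)" "?X = {}"
      by (simp_all add: tight_def)
  qed
  \<comment> \<open>An entering arc also crosses some tight \<open>T\<close>, hence runs from
    \<open>T - S\<close> to \<open>S - T\<close>, which \<open>lattice\<close> forbids.\<close>
  have no_enter: "tail G e \<in> S" if "tight S" "e \<in> A" "head G e \<in> S" for S e
  proof (rule ccontr)
    assume "tail G e \<notin> S"
    moreover obtain T where "tight T" "e \<in> cut_arcs G A T" using crosses \<open>e \<in> A\<close> by blast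
    ultimately show False using lattice(3)[of T S] that by (auto simp: cut_arcs_def)
  qed
  have "card {e \<in> A. head G e = w} = card {e \<in> A. tail G e = w}" if w: "w \<noteq> u" "w \<noteq> v" for w
  proof -
    let ?I = "{e \<in> A. head G e = w}" and ?O = "{e \<in> A. tail G e = w}"
    have fins: "finite ?I" "finite ?O" using fin by auto
    have out_le: "card ?O \<le> card ?I" if ne: "?O \<noteq> {}"
    proof -
      \<comment> \<open>Intersecting tight sets crossed by the single arcs gives one tight set that
        all arcs leaving \<open>w\<close> cross.\<close>
      have "\<exists>S. tight S \<and> w \<in> S \<and> (\<forall>e\<in>B. head G e \<notin> S)" if "finite B" "B \<noteq> {}" "B \<subseteq> ?O" for B
        using that
      proof (induction B rule: finite_ne_induct)
        case (singleton e)
        then show ?case using crosses[of e] by (auto simp: cut_arcs_def)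
      next
        case (insert e B)
        then obtain S where S: "tight S" "w \<in> S" "\<forall>e\<in>B. head G e \<notin> S" by auto
        obtain T where T: "tight T" "e \<in> cut_arcs G A T" using crosses[of e] insert by auto
        have "tight (S \<inter> T)" using lattice S T by blast
        then show ?case using S T insert.prems by (intro exI[of _ "S \<inter> T"]) (auto simp: cut_arcs_def)
      qed
      from this[OF fins(2) ne] obtain S where S: "tight S" "w \<in> S" "\<forall>e\<in>?O. head G e \<notin> S" by auto
      have sub: "?O \<subseteq> cut_arcs G A S" using S by (auto simp: cut_arcs_def)
      \<comment> \<open>Taking \<open>w\<close> out of \<open>S\<close> trades its outgoing arcs for
        its incoming ones, whose tails lie in \<open>S\<close> by \<open>no_enter\<close>.\<close>
      have eq: "cut_arcs G A (S - {w}) = (cut_arcs G A S - ?O) \<union> ?I"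
        using S no_enter[OF S(1)] no_loop by (auto simp: cut_arcs_def)
      have "k \<le> card (cut_arcs G A (S - {w}))" using S w by (intro lower) (auto simp: tight_def)
      also have "\<dots> \<le> card (cut_arcs G A S - ?O) + card ?I" unfolding eq by (rule card_Un_le)
      also have "\<dots> = k - card ?O + card ?I"
        using S sub fins by (simp add: card_Diff_subset tight_def)
      finally have "k \<le> k - card ?O + card ?I" .
      \<comment> \<open>This bound keeps the truncated subtraction of naturals exact.\<close>
      moreover have "card ?O \<le> k" using card_mono[OF fin_cut sub] S by (simp add: tight_def)
      ultimately show ?thesis by linarith
    qed
    have in_le: "card ?I \<le> card ?O" if ne: "?I \<noteq> {}"
    proof -
      \<comment> \<open>The dual argument: a union of tight sets contains the tails of all arcs into
        \<open>w\<close> but not \<open>w\<close>, and then \<open>w\<close> is moved into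
        it.\<close>
      have "\<exists>S. tight S \<and> w \<notin> S \<and> (\<forall>e\<in>B. tail G e \<in> S)" if "finite B" "B \<noteq> {}" "B \<subseteq> ?I" for B
        using that
      proof (induction B rule: finite_ne_induct)
        case (singleton e)
        then show ?case using crosses[of e] by (auto simp: cut_arcs_def)
      next
        case (insert e B)
        then obtain S where S: "tight S" "w \<notin> S" "\<forall>e\<in>B. tail G e \<in> S" by auto
        obtain T where T: "tight T" "e \<in> cut_arcs G A T" using crosses[of e] insert by auto
        have "tight (S \<union> T)" using lattice S T by blast
        then show ?case using S T insert.prems by (intro exI[of _ "S \<union> T"]) (auto simp: cut_arcs_def)
      qed
      from this[OF fins(1) ne] obtain S where S: "tight S" "w \<notin> S" "\<forall>e\<in>?I. tail G e \<in> S" by auto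
      have sub: "?I \<subseteq> cut_arcs G A S" using S by (auto simp: cut_arcs_def)
      have eq: "cut_arcs G A (insert w S) = (cut_arcs G A S - ?I) \<union> ?O"
        using S no_enter[OF S(1)] no_loop by (auto simp: cut_arcs_def)
      have "k \<le> card (cut_arcs G A (insert w S))" using S w by (intro lower) (auto simp: tight_def)
      also have "\<dots> \<le> card (cut_arcs G A S - ?I) + card ?O" unfolding eq by (rule card_Un_le)
      also have "\<dots> = k - card ?I + card ?O"
        using S sub fins by (simp add: card_Diff_subset tight_def)
      finally have "k \<le> k - card ?I + card ?O" .
      moreover have "card ?I \<le> k" using card_mono[OF fin_cut sub] S by (simp add: tight_def)
      ultimately show ?thesis by linarith
    qed
    show ?thesis
    proof (rule le_antisym)
      show "card ?I \<le> card ?O"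
      proof (cases "?I = {}")
        case True
        show ?thesis unfolding True by simp
      qed (rule in_le)
      show "card ?O \<le> card ?I"
      proof (cases "?O = {}")
        case True
        show ?thesis unfolding True by simp
      qed (rule out_le)
    qed
  qed
  then show thesis using that[OF A(1) lower] by simp
qed

section \<open>Path decompositions\<close>

text \<open>A decomposition of the arc set \<open>A\<close> into arc-disjoint \<open>u\<close>-\<open>v\<close> paths is encoded by the
  relation \<open>\<sigma>\<close> between an arc and the next arc on its path.\<close>

locale path_decomposition = fin_digraph G
  for G :: "('a, 'b) pre_digraph" +
  fixes u v :: 'a and A :: "'b set" and \<sigma> :: "('b \<times> 'b) set"
  assumes acyclic: "acyclic (arcs_ends G)"
    and no_in: "in_arcs G u = {}"
    and no_out: "out_arcs G v = {}"
    and A_arcs: "A \<subseteq> arcs G"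
    and succ_arcs: "(e, f) \<in> \<sigma> \<Longrightarrow> e \<in> A \<and> f \<in> A \<and> head G e = tail G f"
    and succ_unique: "single_valued \<sigma>"
    and pred_unique: "single_valued (\<sigma>\<inverse>)"
    and has_succ: "e \<in> A \<Longrightarrow> head G e \<noteq> v \<Longrightarrow> \<exists>f. (e, f) \<in> \<sigma>"
    and has_pred: "f \<in> A \<Longrightarrow> tail G f \<noteq> u \<Longrightarrow> \<exists>e. (e, f) \<in> \<sigma>"

text \<open>At each inner node, balance yields a bijection from the incoming to the outgoing arcs of
  \<open>A\<close>; \<open>\<sigma>\<close> is the union of these bijections.\<close>

lemma (in fin_digraph) path_decomposition_exists:
  assumes "acyclic (arcs_ends G)" "in_arcs G u = {}" "out_arcs G v = {}" "A \<subseteq> arcs G"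
    and bal: "\<And>w. w \<noteq> u \<Longrightarrow> w \<noteq> v \<Longrightarrow> card {e \<in> A. head G e = w} = card {e \<in> A. tail G e = w}"
  obtains \<sigma> where "path_decomposition G u v A \<sigma>"
proof -
  have "finite A" using finite_subset[OF assms(4)] by simp
  then have "\<exists>\<beta>. bij_betw \<beta> {e \<in> A. head G e = w} {e \<in> A. tail G e = w}" if "w \<noteq> u" "w \<noteq> v" for w
    using bal[OF that] by (intro finite_same_card_bij) auto
  then obtain \<beta> where \<beta>: "\<And>w. w \<noteq> u \<Longrightarrow> w \<noteq> v \<Longrightarrow>
      bij_betw (\<beta> w) {e \<in> A. head G e = w} {e \<in> A. tail G e = w}"
    by metis
  have ne: "head G e \<noteq> u" "tail G e \<noteq> v" if "e \<in> A" for e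
    using that assms(2-4) by (auto simp: in_arcs_def out_arcs_def)
  define \<sigma> where "\<sigma> = {(e, \<beta> (head G e) e) |e. e \<in> A \<and> head G e \<noteq> v}"
  have maps: "\<beta> (head G e) e \<in> A \<and> tail G (\<beta> (head G e) e) = head G e" if "e \<in> A" "head G e \<noteq> v" for e
    using bij_betwE[OF \<beta>[of "head G e"]] that ne by blast
  have "path_decomposition G u v A \<sigma>"
  proof
    show "single_valued \<sigma>" by (auto simp: \<sigma>_def single_valued_def)
    show "single_valued (\<sigma>\<inverse>)"
    proof (rule single_valuedI)
      fix f e e' assume "(f, e) \<in> \<sigma>\<inverse>" "(f, e') \<in> \<sigma>\<inverse>"
      then have e: "e \<in> A" "head G e \<noteq> v" "f = \<beta> (head G e) e" "e' \<in> A" "head G e' \<noteq> v" "f = \<beta> (head G e') e'"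
        by (auto simp: \<sigma>_def)
      then have "head G e = head G e'" using maps by metis
      then show "e = e'"
        using e ne bij_betw_imp_inj_on[OF \<beta>[of "head G e"]] by (auto dest: inj_onD)
    qed
    fix f assume f: "f \<in> A" "tail G f \<noteq> u"
    have "f \<in> \<beta> (tail G f) ` {e \<in> A. head G e = tail G f}"
      using bij_betw_imp_surj_on[OF \<beta>[of "tail G f"]] f ne by simp
    then obtain e where e: "f = \<beta> (head G e) e" "e \<in> A" "head G e = tail G f" by auto
    then have "head G e \<noteq> v" using ne(2)[OF f(1)] by simp
    with e have "(e, f) \<in> \<sigma>" unfolding \<sigma>_def by simp
    then show "\<exists>e. (e, f) \<in> \<sigma>" by blast
  qed (use assms maps in \<open>auto simp: \<sigma>_def\<close>)
  then show thesis by (rule that)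
qed

context path_decomposition
begin

text \<open>Carries acyclicity over from \<open>G\<close> to \<open>\<sigma>\<close>.\<close>

lemma arc_tails_trancl: "(e, f) \<in> \<sigma>\<^sup>+ \<Longrightarrow> (tail G e, tail G f) \<in> (arcs_ends G)\<^sup>+"
proof (induction rule: trancl_induct)
  case (base f)
  then show ?case using succ_arcs[OF base] A_arcs by (force simp: arcs_ends_conv)
next
  case (step f g)
  have "(tail G f, tail G g) \<in> arcs_ends G"
    using succ_arcs[OF step(2)] A_arcs by (force simp: arcs_ends_conv)
  then show ?case using step by auto
qed

lemma succ_rtrancl_antisym: "(e, f) \<in> \<sigma>\<^sup>* \<Longrightarrow> (f, e) \<in> \<sigma>\<^sup>* \<Longrightarrow> e = f"
  using arc_tails_trancl acyclic unfolding acyclic_def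
  by (metis rtranclD trancl_rtrancl_trancl)

lemma no_pred: "tail G f = u \<Longrightarrow> (e, f) \<notin> \<sigma>"
  using succ_arcs[of e f] no_in A_arcs by (fastforce simp: in_arcs_def)

lemma no_succ: "head G e = v \<Longrightarrow> (e, f) \<notin> \<sigma>"
  using succ_arcs[of e f] no_out A_arcs by (fastforce simp: out_arcs_def)

lemma rtrancl_arcs: "(e, f) \<in> \<sigma>\<^sup>* \<Longrightarrow> e \<in> A \<longleftrightarrow> f \<in> A"
  by (induction rule: rtrancl_induct) (auto dest: succ_arcs)

lemma wf_arcs_ends: "wf (arcs_ends G)" "wf ((arcs_ends G)\<inverse>)"
proof -
  have "finite (arcs_ends G)" by (simp add: arcs_ends_def)
  then show "wf (arcs_ends G)" "wf ((arcs_ends G)\<inverse>)"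
    using acyclic by (simp_all add: finite_acyclic_wf finite_acyclic_wf_converse)
qed

text \<open>Stepping to predecessors moves tails backwards in a finite acyclic graph, so it ends,
  and \<open>has_pred\<close> lets it end only at \<open>u\<close>.\<close>

lemma first_arc_exists: "f \<in> A \<Longrightarrow> \<exists>e\<in>A. tail G e = u \<and> (e, f) \<in> \<sigma>\<^sup>*"
proof (induction "tail G f" arbitrary: f rule: wf_induct_rule[OF wf_arcs_ends(1)])
  case 1
  show ?case
  proof (cases "tail G f = u")
    case False
    then obtain g where g: "(g, f) \<in> \<sigma>" using has_pred 1(2) by blast
    then have "(tail G g, tail G f) \<in> arcs_ends G"
      using succ_arcs[OF g] A_arcs by (force simp: arcs_ends_conv)
    then obtain e where "e \<in> A" "tail G e = u" "(e, g) \<in> \<sigma>\<^sup>*" using 1(1)[of g] succ_arcs[OF g] by blast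
    then show ?thesis using rtrancl_into_rtrancl[OF _ g] by blast
  qed (use 1 in blast)
qed

lemma last_arc_exists: "e \<in> A \<Longrightarrow> \<exists>f\<in>A. head G f = v \<and> (e, f) \<in> \<sigma>\<^sup>*"
proof (induction "head G e" arbitrary: e rule: wf_induct_rule[OF wf_arcs_ends(2)])
  case 1
  show ?case
  proof (cases "head G e = v")
    case False
    then obtain g where g: "(e, g) \<in> \<sigma>" using has_succ 1(2) by blast
    then have "(head G e, head G g) \<in> arcs_ends G"
      using succ_arcs[OF g] A_arcs by (force simp: arcs_ends_conv)
    then obtain f where "f \<in> A" "head G f = v" "(g, f) \<in> \<sigma>\<^sup>*" using 1(1)[of g] succ_arcs[OF g] by blast
    then show ?thesis using converse_rtrancl_into_rtrancl[OF g] by blast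
  qed (use 1 in blast)
qed

text \<open>A path is identified with its first arc.\<close>

definition path_of :: "'b \<Rightarrow> 'b" where
  "path_of f = (SOME e. e \<in> A \<and> tail G e = u \<and> (e, f) \<in> \<sigma>\<^sup>*)"

lemma path_of:
  assumes "f \<in> A"
  shows "path_of f \<in> A" "tail G (path_of f) = u" "(path_of f, f) \<in> \<sigma>\<^sup>*"
  using someI_ex[of "\<lambda>e. e \<in> A \<and> tail G e = u \<and> (e, f) \<in> \<sigma>\<^sup>*"] first_arc_exists[OF assms]
  unfolding path_of_def by blast+

lemma path_of_first_arc: "e \<in> A \<Longrightarrow> tail G e = u \<Longrightarrow> path_of e = e"
  using path_of[of e] no_pred by (metis rtranclE)

text \<open>The first arcs found for \<open>e\<close> and for \<open>f\<close> both precede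
  \<open>f\<close>, so they are comparable because predecessors are unique. Having no predecessors
  themselves, they coincide.\<close>

lemma path_of_rtrancl:
  assumes "(e, f) \<in> \<sigma>\<^sup>*" "e \<in> A"
  shows "path_of f = path_of e"
proof -
  have f: "f \<in> A" using assms rtrancl_arcs by blast
  have "(path_of e, f) \<in> \<sigma>\<^sup>*" using assms path_of(3) by (meson rtrancl_trans)
  then have "(f, path_of e) \<in> (\<sigma>\<inverse>)\<^sup>*" "(f, path_of f) \<in> (\<sigma>\<inverse>)\<^sup>*"
    using path_of(3)[OF f] by (simp_all add: rtrancl_converse)
  from single_valued_confluent[OF pred_unique this]
  have "(path_of f, path_of e) \<in> \<sigma>\<^sup>* \<or> (path_of e, path_of f) \<in> \<sigma>\<^sup>*"
    by (auto simp: rtrancl_converse)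
  then show ?thesis using path_of(2) assms(2) f no_pred by (metis rtranclE)
qed

lemma path_of_succ: "(e, f) \<in> \<sigma> \<Longrightarrow> path_of f = path_of e"
  using path_of_rtrancl succ_arcs by blast

lemma same_path_comparable:
  assumes "e \<in> A" "f \<in> A" "path_of e = path_of f"
  shows "(e, f) \<in> \<sigma>\<^sup>* \<or> (f, e) \<in> \<sigma>\<^sup>*"
  using single_valued_confluent[OF succ_unique] path_of(3) assms by metis

text \<open>Serves to show that a walk repeats no arc and meets the arcs of one path in path
  order.\<close>

lemma awalk_arc_order:
  "awalk x (e # p) y \<Longrightarrow> f \<in> set p \<Longrightarrow> (tail G e, tail G f) \<in> (arcs_ends G)\<^sup>+"
proof (induction p arbitrary: e x)
  case (Cons g p)
  have eg: "(tail G e, tail G g) \<in> arcs_ends G"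
    using Cons.prems(1) by (auto simp: awalk_Cons_iff arcs_ends_conv)
  show ?case
  proof (cases "f = g")
    case False
    then have "(tail G g, tail G f) \<in> (arcs_ends G)\<^sup>+"
      using Cons.IH[of "head G e" g] Cons.prems by (auto simp: awalk_Cons_iff)
    then show ?thesis using eg by (meson trancl_into_trancl2)
  qed (use eg in auto)
qed simp

lemma same_path_awalk_order:
  assumes "awalk x (e # p) y" "f \<in> set (e # p)" "e \<in> A" "f \<in> A" "path_of e = path_of f"
  shows "(e, f) \<in> \<sigma>\<^sup>*"
proof (cases "f = e")
  case False
  then have "(tail G e, tail G f) \<in> (arcs_ends G)\<^sup>+" using awalk_arc_order assms by auto
  then have "(f, e) \<notin> \<sigma>\<^sup>+" using arc_tails_trancl acyclic unfolding acyclic_def by (meson trancl_trans)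
  then show ?thesis using same_path_comparable[OF assms(3-5)] False by (metis rtranclD)
qed simp

lemma awalk_distinct: "awalk x p y \<Longrightarrow> distinct p"
proof (induction p arbitrary: x)
  case (Cons e p)
  then have "e \<notin> set p" using awalk_arc_order acyclic unfolding acyclic_def by blast
  then show ?case using Cons by (auto simp: awalk_Cons_iff)
qed simp

end

section \<open>Codes along a walk\<close>

context path_decomposition
begin

text \<open>\<open>offered x z P Y w y\<close>: the value \<open>y\<close> is available at \<open>w\<close> from the walk, which starts at \<open>x\<close>
  with the value \<open>z\<close> and has the arcs \<open>P\<close>.

  In \<open>walk_code x p L a b Y\<close>, the list \<open>L\<close> names the paths that the walk \<open>p\<close> joins, in this
  order; the path \<open>i\<close> starts with the value \<open>b i\<close>.  Each time the walk joins a path \<open>i\<close> of \<open>L\<close>, its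
  value grows by \<open>b i\<close> and replaces that of the path from there on, so that the walk must start
  with \<open>a\<close> minus the sum of these \<open>b i\<close> in order to end with \<open>a\<close>.\<close>

definition offered :: "'a \<Rightarrow> 'g \<Rightarrow> 'b set \<Rightarrow> ('b \<Rightarrow> 'g) \<Rightarrow> 'a \<Rightarrow> 'g \<Rightarrow> bool" where
  "offered x z P Y w y \<longleftrightarrow> (w = x \<and> y = z) \<or> (\<exists>g\<in>P. head G g = w \<and> y = Y g)"

definition walk_code ::
    "'a \<Rightarrow> 'b list \<Rightarrow> 'b list \<Rightarrow> 'g::ab_group_add \<Rightarrow> ('b \<Rightarrow> 'g) \<Rightarrow> ('b \<Rightarrow> 'g) \<Rightarrow> bool" where
  "walk_code x p L a b Y \<longleftrightarrow>
    (let off = offered x (a - sum_list (map b L)) (set p) Y in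
      (\<forall>e\<in>A. tail G e = u \<longrightarrow> Y e = b e \<or> (\<exists>y. off (tail G e) y \<and> Y e = b e + y)) \<and>
      (\<forall>e f. (e, f) \<in> \<sigma> \<longrightarrow> Y f = Y e \<or> (\<exists>y. off (tail G f) y \<and> Y f = Y e + y)) \<and>
      (\<forall>e\<in>arcs G - A. Y e = 0 \<or> off (tail G e) (Y e)) \<and>
      (\<forall>e\<in>A. path_of e \<notin> set L \<longrightarrow> Y e = b (path_of e)) \<and>
      (\<forall>L1 L2. \<forall>f\<in>A. L = L1 @ path_of f # L2 \<longrightarrow> head G f = v \<longrightarrow> Y f = a - sum_list (map b L2)) \<and>
      (p \<noteq> [] \<longrightarrow> Y (last p) = a))"

text \<open>Locates where the value that the walk hands to \<open>g\<close> comes from: the start of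
  the walk or the arc just before.\<close>

lemma awalk_arc_enters:
  assumes "awalk x (p @ g # q) y"
  shows "(p = [] \<and> tail G g = x) \<or> (p \<noteq> [] \<and> tail G g = head G (last p))"
  using assms
proof (induction p arbitrary: x)
  case (Cons e p)
  then show ?case by (auto simp: awalk_Cons_iff simp del: awalk_append_iff)
qed (simp add: awalk_Cons_iff)

text \<open>Base case of the induction over walks: nothing is joined, so \<open>a\<close> travels
  unchanged along the walk and every path keeps its starting value.\<close>

lemma walk_code_avoiding:
  fixes a :: "'g::ab_group_add"
  assumes w: "awalk x p y" and avoid: "set p \<inter> A = {}"
  shows "walk_code x p [] a b (\<lambda>e. if e \<in> A then b (path_of e) else if e \<in> set p then a else 0)"
proof -
  define Y where "Y = (\<lambda>e. if e \<in> A then b (path_of e) else if e \<in> set p then a else 0)"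
  have p: "Y g = a" if "g \<in> set p" for g using that avoid by (auto simp: Y_def)
  have "offered x a (set p) Y (tail G g) a" if "g \<in> set p" for g
  proof -
    obtain q r where pq: "p = q @ g # r" using \<open>g \<in> set p\<close> by (meson split_list)
    then show ?thesis using awalk_arc_enters[of x q g r y] w p
      by (cases "q = []") (auto simp: offered_def intro!: bexI[of _ "last q"] simp del: awalk_append_iff)
  qed
  then have "walk_code x p [] a b Y"
    using p path_of_first_arc path_of_succ succ_arcs
    unfolding walk_code_def Let_def by (auto simp: Y_def)
  then show ?thesis by (simp add: Y_def)
qed

text \<open>The walk is followed to its first arc \<open>e\<close> on some path of the decomposition; that path is
  then used up to the last arc \<open>f\<close> of the walk on it, so each path is joined at most once.\<close>

lemma walk_code_step:
  fixes a :: "'g::ab_group_add"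
  assumes w: "awalk x p y" and p: "p = q @ e # r" "e # r = m @ f # n"
    and q: "set q \<inter> A = {}" and e: "e \<in> A" and f: "f \<in> A" "path_of f = path_of e"
    and n: "\<forall>g\<in>set n \<inter> A. path_of g \<noteq> path_of e"
    and L: "set L \<subseteq> path_of ` (set n \<inter> A)" and Y: "walk_code (head G f) n L a b Y"
  shows "\<exists>Y. walk_code x p (path_of e # L) a b Y"
proof -
  define i where "i = path_of e"
  \<comment> \<open>\<open>z'\<close> is the value with which the rest \<open>n\<close> of the walk
    starts at the head of \<open>f\<close>; \<open>z\<close> is the value on the way to
    \<open>e\<close>, chosen so that joining path \<open>i\<close> turns \<open>b i\<close> into
    \<open>z'\<close>.\<close>
  define z' where "z' = a - sum_list (map b L)"
  define z where "z = z' - b i"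
  \<comment> \<open>Path \<open>i\<close> carries \<open>z'\<close> from \<open>e\<close> to its
    end, also on any arcs after \<open>f\<close>, where the walk has left it.\<close>
  define Y' where "Y' g = (if g \<in> set q then z
      else if g \<in> A \<and> path_of g = i then (if (e, g) \<in> \<sigma>\<^sup>* then z' else b i) else Y g)" for g
  define off where "off = offered (head G f) z' (set n) Y"
  define off' where "off' = offered x z (set p) Y'"
  have Y1: "\<And>g. g \<in> A \<Longrightarrow> tail G g = u \<Longrightarrow> Y g = b g \<or> (\<exists>y. off (tail G g) y \<and> Y g = b g + y)"
    and Y2: "\<And>g h. (g, h) \<in> \<sigma> \<Longrightarrow> Y h = Y g \<or> (\<exists>y. off (tail G h) y \<and> Y h = Y g + y)"
    and Y3: "\<And>g. g \<in> arcs G - A \<Longrightarrow> Y g = 0 \<or> off (tail G g) (Y g)"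
    and Y4: "\<And>g. g \<in> A \<Longrightarrow> path_of g \<notin> set L \<Longrightarrow> Y g = b (path_of g)"
    and Y5: "\<And>L1 L2 g. g \<in> A \<Longrightarrow> L = L1 @ path_of g # L2 \<Longrightarrow> head G g = v \<Longrightarrow>
      Y g = a - sum_list (map b L2)"
    and Y6: "n \<noteq> [] \<Longrightarrow> Y (last n) = a"
    using Y unfolding walk_code_def Let_def off_def z'_def by blast+
  have pn: "p = (q @ m) @ f # n" using p by simp
  have dist: "distinct p" using awalk_distinct w by blast
  have n_not_q: "set n \<inter> set q = {}" using dist pn by auto
  have "awalk (tail G e) (e # r) y" using w unfolding p(1) by (auto simp: awalk_Cons_iff)
  then have ef: "(e, f) \<in> \<sigma>\<^sup>*"
    using same_path_awalk_order[of _ e r y f] e f p(2) by (metis in_set_conv_decomp)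
  have q_not_A: "g \<notin> set q" if "g \<in> A" for g using that q by blast
  have Y'_f: "Y' f = z'" using f ef q_not_A by (simp add: Y'_def i_def)
  have Y'_n: "Y' g = Y g" if "g \<in> set n" for g
    using that n n_not_q by (auto simp: Y'_def i_def)
  \<comment> \<open>The rest of the walk starts with \<open>z'\<close> at the head of
    \<open>f\<close>; in the whole walk this value is supplied by the arc \<open>f\<close>
    itself.\<close>
  have off_off': "off' w' y'" if "off w' y'" for w' y'
    using that Y'_f Y'_n pn unfolding off_def off'_def offered_def by force
  \<comment> \<open>The condition on \<open>q1\<close> admits the arcs of \<open>q\<close> and also
    \<open>e\<close>; all of them find \<open>z\<close> at their tails.\<close>
  have off'_q: "off' (tail G g) z" if g: "p = q1 @ g # q2" "set q1 \<subseteq> set q" for q1 g q2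
  proof (cases "q1 = []")
    case True
    then show ?thesis using awalk_arc_enters[of x q1 g q2 y] w g by (simp add: off'_def offered_def)
  next
    case False
    then have "last q1 \<in> set q" "last q1 \<in> set p" using g by auto
    moreover have "tail G g = head G (last q1)" using awalk_arc_enters[of x q1 g q2 y] w g False by simp
    ultimately show ?thesis unfolding off'_def offered_def Y'_def by auto
  qed
  have off'_e: "off' (tail G e) z" using off'_q p by blast
  have i: "i \<in> A" "tail G i = u" "(i, e) \<in> \<sigma>\<^sup>*" using path_of[OF e] by (simp_all add: i_def)
  have iL: "i \<notin> set L" using L n by (fastforce simp: i_def)
  have Y'_other: "Y' g = Y g" if "g \<in> A" "path_of g \<noteq> i" for g
    using that q_not_A by (simp add: Y'_def)
  have Y'_on: "Y' g = (if (e, g) \<in> \<sigma>\<^sup>* then z' else b i)" if "g \<in> A" "path_of g = i" for g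
    using that q_not_A by (simp add: Y'_def)
  have 1: "Y' g = b g \<or> (\<exists>y. off' (tail G g) y \<and> Y' g = b g + y)" if g: "g \<in> A" "tail G g = u" for g
  proof (cases "path_of g = i")
    case True
    then have gi: "g = i" using path_of_first_arc g by simp
    show ?thesis
    proof (cases "(e, g) \<in> \<sigma>\<^sup>*")
      case True
      \<comment> \<open>A first arc at or after \<open>e\<close> is \<open>e\<close> itself: the
        walk joins the path at its very start.\<close>
      then have "e = g" using succ_rtrancl_antisym i gi by blast
      then have "Y' g = b g + z" using Y'_on[OF g(1)] \<open>path_of g = i\<close> gi by (simp add: z_def)
      then show ?thesis using off'_e \<open>e = g\<close> by blast
    qed (use Y'_on[OF g(1)] \<open>path_of g = i\<close> gi in simp)
  next
    case False
    then show ?thesis using Y1[OF g] Y'_other[OF g(1)] off_off' by metis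
  qed
  have 2: "Y' h = Y' g \<or> (\<exists>y. off' (tail G h) y \<and> Y' h = Y' g + y)" if gh: "(g, h) \<in> \<sigma>" for g h
  proof (cases "path_of g = i")
    case True
    then have A: "g \<in> A" "h \<in> A" "path_of h = i" using gh succ_arcs path_of_succ by auto
    \<comment> \<open>The cases are the joining arc, the arcs of the path after it and those before
      it.\<close>
    consider "h = e" | "h \<noteq> e" "(e, h) \<in> \<sigma>\<^sup>*" | "(e, h) \<notin> \<sigma>\<^sup>*" by blast
    then show ?thesis
    proof cases
      case 1
      have "(e, g) \<notin> \<sigma>\<^sup>*"
      proof
        assume "(e, g) \<in> \<sigma>\<^sup>*"
        then have "(e, e) \<in> \<sigma>\<^sup>+" using gh 1 by (metis rtrancl_into_trancl1)
        then show False using arc_tails_trancl acyclic by (auto simp: acyclic_def)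
      qed
      then have "Y' h = Y' g + z" using 1 Y'_on A True by (simp add: z_def)
      then show ?thesis using off'_e 1 by blast
    next
      case 2
      then obtain g' where "(e, g') \<in> \<sigma>\<^sup>*" "(g', h) \<in> \<sigma>" by (metis rtranclE)
      then have "(e, g) \<in> \<sigma>\<^sup>*" using gh pred_unique by (auto dest: single_valuedD)
      then show ?thesis using 2 Y'_on A True by simp
    next
      case 3
      then have "(e, g) \<notin> \<sigma>\<^sup>*" using gh by (meson rtrancl_into_rtrancl)
      then show ?thesis using 3 Y'_on A True by simp
    qed
  next
    case False
    then have "Y' g = Y g" "Y' h = Y h" using gh succ_arcs path_of_succ Y'_other by auto
    then show ?thesis using Y2[OF gh] off_off' by metis
  qed
  have 3: "Y' g = 0 \<or> off' (tail G g) (Y' g)" if g: "g \<in> arcs G - A" for g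
  proof (cases "g \<in> set q")
    case True
    then obtain q1 q2 where "q = q1 @ g # q2" by (meson split_list)
    then have "off' (tail G g) z" using p by (intro off'_q[of q1 g "q2 @ e # r"]) auto
    then show ?thesis using True by (simp add: Y'_def)
  next
    case False
    then have "Y' g = Y g" using g by (simp add: Y'_def)
    then show ?thesis using Y3[OF g] off_off' by metis
  qed
  have 4: "Y' g = b (path_of g)" if "g \<in> A" "path_of g \<notin> set (i # L)" for g
    using that Y4 Y'_other by simp
  have 5: "Y' g = a - sum_list (map b L2)"
    if g: "g \<in> A" "i # L = L1 @ path_of g # L2" "head G g = v" for L1 L2 g
  proof (cases L1)
    case Nil
    then have gi: "path_of g = i" "L = L2" using g by auto
    have "(e, g) \<in> \<sigma>\<^sup>* \<or> (g, e) \<in> \<sigma>\<^sup>*" using same_path_comparable e g gi by (simp add: i_def)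
    \<comment> \<open>A last arc has no successor, so it lies at or after \<open>e\<close> and
      carries \<open>z'\<close>.\<close>
    then have "(e, g) \<in> \<sigma>\<^sup>*" using no_succ[OF g(3)] by (metis converse_rtranclE rtrancl.rtrancl_refl)
    then show ?thesis using Y'_on g gi by (simp add: z'_def)
  next
    case (Cons j L1')
    then have "L = L1' @ path_of g # L2" using g by simp
    moreover from this have "path_of g \<noteq> i" using iL by auto
    ultimately show ?thesis using Y5 g Y'_other by simp
  qed
  have 6: "Y' (last p) = a"
  proof (cases "n = []")
    case True
    \<comment> \<open>With no walk left after \<open>f\<close>, the value \<open>z'\<close> is
      \<open>a\<close>.\<close>
    then have "L = []" using L by simp
    then show ?thesis using True pn Y'_f by (simp add: z'_def)
  next
    case False
    then show ?thesis using pn Y6 Y'_n by simp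
  qed
  have off'_eq: "off' = offered x (a - sum_list (map b (i # L))) (set p) Y'"
    by (simp add: off'_def z_def z'_def algebra_simps)
  then have "walk_code x p (i # L) a b Y'"
    unfolding walk_code_def Let_def off'_eq[symmetric]
    by (intro conjI ballI allI impI) (rule 1 2 3 4 5 6; assumption)+
  then show ?thesis unfolding i_def by blast
qed

text \<open>Induction on the length of the walk. \<open>L\<close> is fixed before \<open>a\<close>
  and \<open>b\<close>, so that the starting values can be chosen depending on
  \<open>L\<close>.\<close>

lemma walk_code_exists:
  assumes "awalk x p y"
  shows "\<exists>L. distinct L \<and> set L \<subseteq> path_of ` (set p \<inter> A) \<and>
    (\<forall>(a::'g::ab_group_add) b. \<exists>Y. walk_code x p L a b Y)"
  using assms
proof (induction p arbitrary: x rule: length_induct)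
  case (1 p)
  show ?case
  proof (cases "set p \<inter> A = {}")
    case True
    then show ?thesis using walk_code_avoiding[OF 1(2)] by (intro exI[of _ "[]"]) auto
  next
    case False
    then have "\<exists>e\<in>set p. e \<in> A" by blast
    from split_list_first_prop[OF this] obtain q e r
      where p: "p = q @ e # r" "e \<in> A" "\<forall>g\<in>set q. g \<notin> A" by blast
    have "\<exists>f\<in>set (e # r). f \<in> A \<and> path_of f = path_of e" using p by auto
    from split_list_last_prop[OF this] obtain m f n
      where r: "e # r = m @ f # n" "f \<in> A" "path_of f = path_of e"
        "\<forall>g\<in>set n. \<not> (g \<in> A \<and> path_of g = path_of e)" by blast
    have "p = (q @ m) @ f # n" using p r by simp
    then have n: "awalk (head G f) n y" "length n < length p" "f \<in> set p" "set n \<subseteq> set p"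
      using 1(2) by (auto simp: awalk_Cons_iff)
    obtain L where L: "distinct L" "set L \<subseteq> path_of ` (set n \<inter> A)"
      and Y: "\<And>(a::'g) b. \<exists>Y. walk_code (head G f) n L a b Y"
      using 1(1) n by blast
    have notin: "path_of e \<notin> set L" using L r by fastforce
    have "\<exists>Y. walk_code x p (path_of e # L) a b Y" for a :: 'g and b
      using Y[of a b] walk_code_step[OF 1(2) p(1) r(1) _ p(2) r(2,3) _ L(2)] p(3) r(4) by blast
    moreover have "set (path_of e # L) \<subseteq> path_of ` (set p \<inter> A)" using L n p by auto
    ultimately show ?thesis using L notin by (intro exI[of _ "path_of e # L"]) auto
  qed
qed

end

section \<open>Integral codes\<close>

text \<open>The coefficients are the same for all \<open>W\<close>: \<open>h\<close> lies in the
  integer span of the functions \<open>g j\<close>.\<close>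

definition int_lincomb :: "'j set \<Rightarrow> ('j \<Rightarrow> 'w \<Rightarrow> int) \<Rightarrow> ('w \<Rightarrow> int) \<Rightarrow> bool" where
  "int_lincomb J g h \<longleftrightarrow> (\<exists>c. \<forall>W. h W = (\<Sum>j\<in>J. c j * g j W))"

lemma int_lincomb_generator:
  assumes "finite J" "j \<in> J"
  shows "int_lincomb J g (g j)"
proof -
  have "g j W = (\<Sum>i\<in>J. (if i = j then 1 else 0) * g i W)" for W
    using assms by (simp add: if_distrib[of "\<lambda>x. x * _"] sum.delta cong: if_cong)
  then show ?thesis
    unfolding int_lincomb_def by (intro exI[of _ "\<lambda>i. if i = j then 1 else 0"] allI)
qed

lemma int_lincomb_zero: "int_lincomb J g 0"
  unfolding int_lincomb_def by (intro exI[of _ "\<lambda>_. 0"]) simp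

lemma int_lincomb_add:
  assumes "int_lincomb J g h" "int_lincomb J g k"
  shows "int_lincomb J g (h + k)"
proof -
  obtain c d where "\<forall>W. h W = (\<Sum>j\<in>J. c j * g j W)" "\<forall>W. k W = (\<Sum>j\<in>J. d j * g j W)"
    using assms unfolding int_lincomb_def by blast
  then have "\<forall>W. (h + k) W = (\<Sum>j\<in>J. (c j + d j) * g j W)"
    by (simp add: distrib_right sum.distrib)
  then show ?thesis unfolding int_lincomb_def by (rule exI[of _ "\<lambda>j. c j + d j"])
qed

lemma int_lincomb_uminus:
  assumes "int_lincomb J g h"
  shows "int_lincomb J g (- h)"
proof -
  obtain c where "\<forall>W. h W = (\<Sum>j\<in>J. c j * g j W)"
    using assms unfolding int_lincomb_def by blast
  then have "\<forall>W. (- h) W = (\<Sum>j\<in>J. (- c j) * g j W)"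
    by (simp add: sum_negf)
  then show ?thesis unfolding int_lincomb_def by (rule exI[of _ "\<lambda>j. - c j"])
qed

lemma int_lincomb_diff:
  assumes "int_lincomb J g h" "int_lincomb J g k"
  shows "int_lincomb J g (h - k)"
  using int_lincomb_add[OF assms(1) int_lincomb_uminus[OF assms(2)]] by simp

lemma int_lincomb_sum_list:
  "(\<And>x. x \<in> set xs \<Longrightarrow> int_lincomb J g (f x)) \<Longrightarrow> int_lincomb J g (sum_list (map f xs))"
  by (induction xs) (simp_all add: int_lincomb_zero int_lincomb_add)

text \<open>Reduction mod \<open>N\<close> commutes with sums and products, so integer coefficients
  give an admissible local encoding function.\<close>

lemma linear_function_residue_ring:
  assumes "N > 1"
  shows "linear_function (residue_ring N) T J (\<lambda>x. \<lambda>k\<in>{..<T}. (\<Sum>j\<in>J. c j * x j k) mod N)"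
  unfolding linear_function_def
proof (intro conjI ballI)
  fix x y :: "'a \<Rightarrow> nat \<Rightarrow> int"
  show "(\<lambda>k\<in>{..<T}. (\<Sum>j\<in>J. c j * x j k) mod N) \<in> vecs (residue_ring N) T"
    using assms by (auto simp: vecs_def residue_ring_def)
  have "[(\<Sum>j\<in>J. c j * ((x j k + y j k) mod N)) = (\<Sum>j\<in>J. c j * x j k) + (\<Sum>j\<in>J. c j * y j k)] (mod N)" for k
    unfolding sum.distrib[symmetric] distrib_left[symmetric]
    by (intro cong_sum cong_scalar_left) (simp add: cong_def)
  then show "(\<lambda>k\<in>{..<T}. (\<Sum>j\<in>J. c j * (\<lambda>j\<in>J. \<lambda>k\<in>{..<T}. x j k \<oplus>\<^bsub>residue_ring N\<^esub> y j k) j k) mod N) =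
      (\<lambda>k\<in>{..<T}. (\<lambda>k\<in>{..<T}. (\<Sum>j\<in>J. c j * x j k) mod N) k \<oplus>\<^bsub>residue_ring N\<^esub>
        (\<lambda>k\<in>{..<T}. (\<Sum>j\<in>J. c j * y j k) mod N) k)"
    by (intro restrict_ext) (simp add: residue_ring_def cong_def mod_simps)
next
  fix r and x :: "'a \<Rightarrow> nat \<Rightarrow> int"
  have "[(\<Sum>j\<in>J. c j * ((r * x j k) mod N)) = r * (\<Sum>j\<in>J. c j * x j k)] (mod N)" for k
  proof -
    have "[(\<Sum>j\<in>J. c j * ((r * x j k) mod N)) = (\<Sum>j\<in>J. c j * (r * x j k))] (mod N)"
      by (intro cong_sum cong_scalar_left) (simp add: cong_def)
    also have "(\<Sum>j\<in>J. c j * (r * x j k)) = r * (\<Sum>j\<in>J. c j * x j k)"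
      by (simp add: sum_distrib_left mult_ac)
    finally show ?thesis .
  qed
  then show "(\<lambda>k\<in>{..<T}. (\<Sum>j\<in>J. c j * (\<lambda>j\<in>J. \<lambda>k\<in>{..<T}. r \<otimes>\<^bsub>residue_ring N\<^esub> x j k) j k) mod N) =
      (\<lambda>k\<in>{..<T}. r \<otimes>\<^bsub>residue_ring N\<^esub> (\<lambda>k\<in>{..<T}. (\<Sum>j\<in>J. c j * x j k) mod N) k)"
    by (intro restrict_ext) (simp add: residue_ring_def cong_def mod_simps)
qed

text \<open>Integer linear identities survive reduction mod 2, so \<open>Y\<close> becomes a scalar
  code over the field with two elements.\<close>

lemma feasible_if_integral_code:
  fixes G :: "('a, 'b) pre_digraph" and Y :: "'b \<Rightarrow> (nat \<times> nat \<Rightarrow> int) \<Rightarrow> int"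
  assumes encode: "\<And>e. e \<in> arcs G \<Longrightarrow>
      int_lincomb (node_inputs G n s R (tail G e)) (case_sum (\<lambda>\<mu> W. W \<mu>) Y) (Y e)"
    and decode: "\<And>i j. i \<in> {1..n} \<Longrightarrow> j < R i \<Longrightarrow> int_lincomb (in_arcs G (t i)) Y (\<lambda>W. W (i, j))"
  shows "feasible G n s t R"
proof -
  let ?F = "residue_ring 2"
  define y where "y e X = (\<lambda>k\<in>{..<1::nat}. Y e (\<lambda>\<mu>. X \<mu> k) mod 2)" for e X
  have cong_y: "[c * y e X k = c * Y e (\<lambda>\<mu>. X \<mu> k)] (mod 2)" if "k < 1" for c e X k
    using that by (intro cong_scalar_left) (simp add: y_def cong_def)
  have "linear_network_code G n s R ?F 1 y"
    unfolding linear_network_code_def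
  proof
    fix e assume e: "e \<in> arcs G"
    let ?J = "node_inputs G n s R (tail G e)"
    obtain c where c: "\<And>W. Y e W = (\<Sum>j\<in>?J. c j * case_sum (\<lambda>\<mu> W. W \<mu>) Y j W)"
      using encode[OF e] unfolding int_lincomb_def by blast
    have "y e X = (\<lambda>k\<in>{..<1}. (\<Sum>j\<in>?J. c j * (restrict (case_sum X (\<lambda>e'. y e' X)) ?J) j k) mod 2)" for X
    proof -
      have "[c j * (restrict (case_sum X (\<lambda>e'. y e' X)) ?J) j k
          = c j * case_sum (\<lambda>\<mu> W. W \<mu>) Y j (\<lambda>\<mu>. X \<mu> k)] (mod 2)" if "j \<in> ?J" "k < 1" for j k
        using that by (cases j) (auto intro: cong_y simp del: less_one)
      then have "[(\<Sum>j\<in>?J. c j * (restrict (case_sum X (\<lambda>e'. y e' X)) ?J) j k) = Y e (\<lambda>\<mu>. X \<mu> k)] (mod 2)"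
        if "k < 1" for k
        unfolding c[of "\<lambda>\<mu>. X \<mu> k"] using that by (intro cong_sum) blast
      then show ?thesis unfolding y_def[of e] by (intro restrict_ext) (simp only: cong_def lessThan_iff)
    qed
    then show "\<exists>\<phi>. linear_function ?F 1 ?J \<phi> \<and> (\<forall>X\<in>messages ?F 1 n R.
        y e X = \<phi> (restrict (case_sum X (\<lambda>e'. y e' X)) ?J))"
      using linear_function_residue_ring[of 2 1 ?J c]
      by (intro exI[of _ "\<lambda>x. \<lambda>k\<in>{..<1}. (\<Sum>j\<in>?J. c j * x j k) mod 2"]) simp
  qed
  moreover have "code_solves G n t R ?F 1 y"
    unfolding code_solves_def
  proof
    fix i assume i: "i \<in> {1..n}"
    have "\<forall>j. \<exists>d. j < R i \<longrightarrow> (\<forall>W. W (i, j) = (\<Sum>e\<in>in_arcs G (t i). d e * Y e W))"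
      using decode[OF i] unfolding int_lincomb_def by blast
    then obtain d where d: "\<And>j W. j < R i \<Longrightarrow> W (i, j) = (\<Sum>e\<in>in_arcs G (t i). d j e * Y e W)"
      by metis
    define dec where "dec x j = (\<lambda>k\<in>{..<1::nat}. (\<Sum>e\<in>in_arcs G (t i). d j e * x e k) mod 2)" for x j
    have "dec (\<lambda>e\<in>in_arcs G (t i). y e X) j = X (i, j)"
      if X: "X \<in> messages ?F 1 n R" and j: "j < R i" for X j
    proof -
      have Xij: "X (i, j) \<in> vecs ?F 1"
        using X i j by (auto simp: messages_def msg_index_def)
      show ?thesis
      proof
        fix k
        show "dec (\<lambda>e\<in>in_arcs G (t i). y e X) j k = X (i, j) k"
        proof (cases "k < 1")
          case True
          have "[(\<Sum>e\<in>in_arcs G (t i). d j e * (\<lambda>e\<in>in_arcs G (t i). y e X) e k)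
              = (\<Sum>e\<in>in_arcs G (t i). d j e * Y e (\<lambda>\<mu>. X \<mu> k))] (mod 2)"
            using cong_y[OF True] by (intro cong_sum) simp
          also have "(\<Sum>e\<in>in_arcs G (t i). d j e * Y e (\<lambda>\<mu>. X \<mu> k)) = X (i, j) k"
            using d[OF j, of "\<lambda>\<mu>. X \<mu> k"] by simp
          finally have "dec (\<lambda>e\<in>in_arcs G (t i). y e X) j k = X (i, j) k mod 2"
            using True by (simp add: dec_def cong_def)
          \<comment> \<open>Symbols are represented by 0 and 1, so reduction mod 2 leaves the
            decoded message unchanged.\<close>
          also have "X (i, j) k \<in> {0..1}"
            using Xij True by (auto simp: vecs_def residue_ring_def PiE_def Pi_def)
          then have "X (i, j) k mod 2 = X (i, j) k" by (intro mod_pos_pos_trivial) auto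
          finally show ?thesis .
        next
          case False
          then show ?thesis using Xij by (auto simp: dec_def vecs_def PiE_def extensional_def)
        qed
      qed
    qed
    then show "\<exists>dec. \<forall>X\<in>messages ?F 1 n R. \<forall>j<R i. dec (\<lambda>e\<in>in_arcs G (t i). y e X) j = X (i, j)"
      by blast
  qed
  moreover have "residues_prime 2" by (rule residues_prime.intro) simp
  then have "field ?F" using residues_prime.is_field[of 2] by simp
  moreover have "finite (carrier ?F)" by (simp add: residue_ring_def)
  ultimately show ?thesis unfolding feasible_def by blast
qed

theorem mainTheorem6:
  fixes G :: "('a, 'b) pre_digraph" and s t :: "nat \<Rightarrow> 'a" and R :: "nat \<Rightarrow> nat" and m :: nat
  assumes "1 \<le> m"
    and "multiple_unicast G 2 s t R"
    and "R 1 = 1" and "R 2 = m"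
    and "minimal_instance G 2 s t"
    and "connectivity_level G 2 s t = [1, real (m + 1)]"
  shows "feasible G 2 s t R"
proof -

  \<comment> \<open>Arc-disjoint paths for the second session and a walk for the first\<close>
  interpret multiple_unicast G 2 s t R by fact
  have verts: "s 1 \<in> verts G" "s 2 \<in> verts G" using source_in_verts by auto
  have ends: "in_arcs G (s 1) = {}" "in_arcs G (s 2) = {}" "out_arcs G (t 1) = {}" "out_arcs G (t 2) = {}"
    using source_no_in terminal_no_out by auto
  have flow: "max_flow G (s 1) (t 1) = 1" "max_flow G (s 2) (t 2) = real (m + 1)"
    using assms(6) by (simp_all add: connectivity_level_def upt_rec numeral_2_eq_2)
  have ne: "s 1 \<noteq> t 1" "s 2 \<noteq> t 2"
    using flow max_flow_isolated[of G "s 1" "t 1"] max_flow_isolated[of G "s 2" "t 2"] ends by auto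
  have "m + 1 \<le> card (cut_arcs G (arcs G) S)" if "s 2 \<in> S" "t 2 \<notin> S" for S
    using max_flow_le_cut[OF verts(2) that] flow by simp
  from balanced_subset_of_cuts[of "s 2" "t 2", OF this] obtain A where A: "A \<subseteq> arcs G"
    and cuts: "\<And>S. s 2 \<in> S \<Longrightarrow> t 2 \<notin> S \<Longrightarrow> m + 1 \<le> card (cut_arcs G A S)"
    and bal: "\<And>w. w \<noteq> s 2 \<Longrightarrow> w \<noteq> t 2 \<Longrightarrow> card {e \<in> A. head G e = w} = card {e \<in> A. tail G e = w}"
    by blast
  obtain \<sigma> where "path_decomposition G (s 2) (t 2) A \<sigma>"
    using path_decomposition_exists[OF acyclic ends(2,4) A bal] by blast
  then interpret P: path_decomposition G "s 2" "t 2" A \<sigma> .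
  have "0 < max_flow G (s 1) (t 1)" using flow by simp
  then obtain p where p: "awalk (s 1) p (t 1)"
    using positive_max_flow_awalk[OF verts(1)] by blast
  have "p \<noteq> []" using p ne by (auto simp: awalk_Nil_iff)
  obtain L where L: "distinct L" "set L \<subseteq> P.path_of ` (set p \<inter> A)"
    and code: "\<And>(a :: (nat \<times> nat \<Rightarrow> int) \<Rightarrow> int) b. \<exists>Y. P.walk_code (s 1) p L a b Y"
    using P.walk_code_exists[OF p] by blast

  \<comment> \<open>First arcs and starting values\<close>
  define F where "F = {e \<in> A. tail G e = s 2}"
  have finA: "finite A" using finite_subset[OF A] by simp
  then have finF: "finite F" by (simp add: F_def)
  \<comment> \<open>The arcs of \<open>A\<close> that leave \<open>{s 2}\<close> are first arcs, so
    there are at least \<open>m + 1\<close> paths.\<close>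
  have "m + 1 \<le> card (cut_arcs G A {s 2})" using cuts[of "{s 2}"] ne by auto
  also have "\<dots> \<le> card F" using finF by (intro card_mono) (auto simp: cut_arcs_def F_def)
  finally have cardF: "m + 1 \<le> card F" .
  have LF: "set L \<subseteq> F" using L(2) P.path_of by (auto simp: F_def)
  \<comment> \<open>\<open>e1\<close> is the first path joined by the walk, or any path if none is
    joined. It gets no message of its own; the other paths, at least \<open>m\<close> of them, can
    take one each.\<close>
  obtain e1 where e1: "e1 \<in> F" "L \<noteq> [] \<Longrightarrow> e1 = hd L"
  proof (cases "L = []")
    case True
    moreover have "F \<noteq> {}" using cardF by auto
    ultimately show ?thesis using that by auto
  next
    case False
    then have "hd L \<in> F" using LF hd_in_set by blast
    then show ?thesis using that by blast
  qed
  have "m \<le> card (F - {e1})" using cardF e1(1) finF by simp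
  then obtain \<iota> where \<iota>: "\<iota> ` {..<m} \<subseteq> F - {e1}" "inj_on \<iota> {..<m}"
    using card_le_inj[of "{..<m}" "F - {e1}"] finF by auto
  define a :: "(nat \<times> nat \<Rightarrow> int) \<Rightarrow> int" where "a W = W (1, 0)" for W
  \<comment> \<open>Paths that are assigned no message get the value 0.\<close>
  define b0 :: "'b \<Rightarrow> (nat \<times> nat \<Rightarrow> int) \<Rightarrow> int" where
    "b0 e = (if e \<in> \<iota> ` {..<m} then (\<lambda>W. W (2, inv_into {..<m} \<iota> e)) else 0)" for e
  \<comment> \<open>The value on \<open>e1\<close> cancels those of the other joined paths; then the
    sum over \<open>L\<close> is 0 and the walk can start with the message \<open>a\<close>
    alone.\<close>
  define b where "b e = (if e = e1 then - sum_list (map b0 (tl L)) else b0 e)" for e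
  have b_\<iota>: "b (\<iota> j) = (\<lambda>W. W (2, j))" if "j < m" for j
    using that \<iota> by (auto simp: b_def b0_def inv_into_f_f)
  have sum_b: "sum_list (map b L) = 0"
  proof (cases L)
    case (Cons i L')
    then have "sum_list (map b L') = sum_list (map b0 L')"
      using e1 L(1) by (intro arg_cong[of _ _ sum_list]) (auto simp: b_def)
    moreover have "b i = - sum_list (map b0 L')" using Cons e1 by (simp add: b_def)
    ultimately show ?thesis using Cons by simp
  qed simp
  obtain Y where Y: "P.walk_code (s 1) p L a b Y" using code by blast
  define off where "off = P.offered (s 1) a (set p) Y"
  have Y1: "\<And>g. g \<in> A \<Longrightarrow> tail G g = s 2 \<Longrightarrow> Y g = b g \<or> (\<exists>y. off (tail G g) y \<and> Y g = b g + y)"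
    and Y2: "\<And>g h. (g, h) \<in> \<sigma> \<Longrightarrow> Y h = Y g \<or> (\<exists>y. off (tail G h) y \<and> Y h = Y g + y)"
    and Y3: "\<And>g. g \<in> arcs G - A \<Longrightarrow> Y g = 0 \<or> off (tail G g) (Y g)"
    and Y4: "\<And>g. g \<in> A \<Longrightarrow> P.path_of g \<notin> set L \<Longrightarrow> Y g = b (P.path_of g)"
    and Y5: "\<And>L1 L2 g. g \<in> A \<Longrightarrow> L = L1 @ P.path_of g # L2 \<Longrightarrow> head G g = t 2 \<Longrightarrow>
      Y g = a - sum_list (map b L2)"
    and Y6: "Y (last p) = a"
    using Y \<open>p \<noteq> []\<close> unfolding P.walk_code_def Let_def sum_b diff_zero off_def by blast+
  show ?thesis
  proof (rule feasible_if_integral_code)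

    \<comment> \<open>Encoding at the tail of each arc\<close>
    let ?g = "case_sum (\<lambda>\<mu> W. W \<mu>) Y"
    let ?span = "\<lambda>w. int_lincomb (node_inputs G 2 s R w) ?g"
    have fin: "finite (node_inputs G 2 s R w)" for w
      by (auto simp: node_inputs_def msg_index_def)
    have arc: "?span (head G g) (Y g)" if "g \<in> arcs G" for g
    proof -
      have "Inr g \<in> node_inputs G 2 s R (head G g)" using that by (auto simp: node_inputs_def)
      from int_lincomb_generator[OF fin this, of ?g] show ?thesis by simp
    qed
    have msg: "?span (s i) (\<lambda>W. W (i, j))" if "i \<in> {1..2}" "j < R i" for i j
    proof -
      have "Inl (i, j) \<in> node_inputs G 2 s R (s i)"
        using that by (auto simp: node_inputs_def msg_index_def)
      from int_lincomb_generator[OF fin this, of ?g] show ?thesis by simp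
    qed
    have span_a: "?span (s 1) a" using msg[of 1 0] assms(3) by (simp add: a_def[abs_def])
    have span_b0: "?span (s 2) (b0 e)" for e
    proof (cases "e \<in> \<iota> ` {..<m}")
      case True
      then have "inv_into {..<m} \<iota> e < m" using inv_into_into[of e \<iota> "{..<m}"] by simp
      then show ?thesis using msg[of 2] assms(4) True by (simp add: b0_def)
    qed (simp add: b0_def int_lincomb_zero)
    have span_b: "?span (s 2) (b e)" for e
      using span_b0 by (simp add: b_def int_lincomb_uminus int_lincomb_sum_list)
    have span_off: "?span w y" if "off w y" for w y
    proof -
      have "(w = s 1 \<and> y = a) \<or> (\<exists>g\<in>set p. head G g = w \<and> y = Y g)"
        using that unfolding off_def P.offered_def .
      then show ?thesis
      proof (elim disjE bexE conjE)
        fix g assume "g \<in> set p" and g: "head G g = w" "y = Y g"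
        then have "g \<in> arcs G" using p by (auto simp: awalk_def)
        then show ?thesis using arc[of g] g by simp
      qed (use span_a in simp)
    qed
    fix e assume e: "e \<in> arcs G"
    consider "e \<notin> A" | "e \<in> A" "tail G e = s 2" | "e \<in> A" "tail G e \<noteq> s 2" by blast
    then show "?span (tail G e) (Y e)"
    proof cases
      case 1
      from Y3[of e] e 1 have "Y e = 0 \<or> off (tail G e) (Y e)" by simp
      then show ?thesis
      proof
        assume "Y e = 0"
        then show ?thesis by (simp only: int_lincomb_zero)
      qed (rule span_off)
    next
      case 2
      from Y1[OF 2] show ?thesis
      proof (elim disjE exE conjE)
        assume "Y e = b e"
        then show ?thesis using span_b 2 by simp
      next
        fix y assume y: "off (tail G e) y" "Y e = b e + y"
        have "?span (tail G e) (b e)" using span_b 2 by simp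
        from int_lincomb_add[OF this span_off[OF y(1)]] show ?thesis by (simp only: y(2))
      qed
    next
      case 3
      then obtain g where g: "(g, e) \<in> \<sigma>" using P.has_pred by blast
      then have gY: "?span (tail G e) (Y g)" using arc[of g] P.succ_arcs[OF g] A by auto
      from Y2[OF g] show ?thesis
      proof (elim disjE exE conjE)
        assume "Y e = Y g"
        then show ?thesis using gY by simp
      next
        fix y assume y: "off (tail G e) y" "Y e = Y g + y"
        from int_lincomb_add[OF gY span_off[OF y(1)]] show ?thesis by (simp only: y(2))
      qed
    qed
  next

    \<comment> \<open>Decoding at the two terminals\<close>
    let ?span = "\<lambda>w. int_lincomb (in_arcs G w) Y"
    have arc: "?span (head G g) (Y g)" if "g \<in> arcs G" for g
      using that by (intro int_lincomb_generator) auto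
    have final: "\<exists>g\<in>A. P.path_of g = e \<and> head G g = t 2 \<and> ?span (t 2) (Y g)" if "e \<in> F" for e
    proof -
      have e: "e \<in> A" "tail G e = s 2" using that by (auto simp: F_def)
      then obtain g where g: "g \<in> A" "head G g = t 2" "(e, g) \<in> \<sigma>\<^sup>*" using P.last_arc_exists by blast
      then have "P.path_of g = e" using P.path_of_rtrancl P.path_of_first_arc e by metis
      then show ?thesis using g arc[of g] A by auto
    qed
    fix i j assume i: "i \<in> {1..2::nat}" and j: "j < R i"
    consider "i = 1" | "i = 2" using i by force
    then show "?span (t i) (\<lambda>W. W (i, j))"
    proof cases
      case 1
      have "last p \<in> arcs G" "head G (last p) = t 1"
        using p \<open>p \<noteq> []\<close> by (auto simp: awalk_conv awalk_verts_conv)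
      then have "?span (t 1) a" using arc[of "last p"] Y6 by simp
      then show ?thesis using 1 j assms(3) by (simp add: a_def[abs_def])
    next
      case 2
      define e where "e = \<iota> j"
      have jm: "j < m" using 2 j assms(4) by simp
      then have e: "e \<in> F" "e \<noteq> e1" using \<iota> by (auto simp: e_def)
      obtain g where g: "g \<in> A" "P.path_of g = e" "head G g = t 2" "?span (t 2) (Y g)"
        using final e by blast
      have "?span (t 2) (b e)"
      proof (cases "e \<in> set L")
        case False
        then show ?thesis using Y4[of g] g by simp
      next
        case True
        then obtain L1 L2 where L12: "L = L1 @ e # L2" by (meson split_list)
        \<comment> \<open>\<open>e\<close> differs from \<open>e1\<close>, the head of
          \<open>L\<close>, so some \<open>e'\<close> comes directly before it in
          \<open>L\<close>.\<close>
        then have "L1 \<noteq> []" using e1 e by auto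
        then obtain L0 e' where "L1 = L0 @ [e']" by (metis append_butlast_last_id)
        then have L': "L = L0 @ e' # e # L2" using L12 by simp
        then have "e' \<in> F" using LF by auto
        then obtain g' where g': "g' \<in> A" "P.path_of g' = e'" "head G g' = t 2" "?span (t 2) (Y g')"
          using final by blast
        have "Y g = a - sum_list (map b L2)" using Y5[OF g(1) _ g(3)] L12 g(2) by simp
        moreover have "Y g' = a - sum_list (map b (e # L2))" using Y5[OF g'(1) _ g'(3)] L' g'(2) by simp
        \<comment> \<open>The paths of consecutive entries of \<open>L\<close> deliver values that
          differ by exactly \<open>b e\<close>.\<close>
        ultimately have "b e = Y g - Y g'" by simp
        then show ?thesis using int_lincomb_diff[OF g(4) g'(4)] by (simp only:)
      qed
      then show ?thesis using b_\<iota>[OF jm] 2 by (simp add: e_def)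
    qed
  qed
qed

end
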